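(* Let $N$ and $d$ be positive integers and let $a=p/q\in[0,1]$ be a rational number written with integers $p\ge 0$, $q>0$, $\gcd(p,q)=1$. Then $$ f_{N,d}(p/q)\le (d-1)+\left\lceil \frac{pN-d+1}{q}\right\rceil . $$ Moreover, if $q>p\ge 1$ and $N\ge (q-1)(d-1)$, then $$ f_{N,d}(p/q)= (d-1)+\left\lceil \frac{pN-d+1}{q}\right\rceil . $$
   Context: On $\mathbb{R}^d$ let $\succeq$ be the coordinatewise partial order: for $\mathbf{u}=[u^1,\dots,u^d]$ and $\mathbf{v}=[v^1,\dots,v^d]$, $\mathbf{u}\succeq\mathbf{v}$ means $u^j\ge v^j$ for all $1\le j\le d$. A vector $\mathbf{u}$ is nonnegative if $\mathbf{u}\succeq \mathbf{0}$. Given nonnegative vectors $\mathbf{u}_1,\dots,\mathbf{u}_N\in\mathbb{R}^d$ and a real $a\in[0,1]$, a set of indices $I\subseteq\{1,\dots,N\}$ is called $a$-rich if $\sum_{i\in I}\mathbf{u}_i\succeq a\sum_{i=1}^N\mathbf{u}_i$. Define $f_{N,d}(a)$ as the minimal number $f$ such that for every choice of $N$ nonnegative vectors $\mathbf{u}_1,\dots,\mathbf{u}_N\in\mathbb{R}^d$ there exists an $a$-rich set $I$ with $|I|\le f$. *)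

theory Defs
  imports "HOL-Analysis.Analysis"
begin

definition rich :: "nat \<Rightarrow> (nat \<Rightarrow> real ^ 'd::finite) \<Rightarrow> real \<Rightarrow> nat set \<Rightarrow> bool" where
  "rich N u a I \<longleftrightarrow> I \<subseteq> {1..N} \<and> (\<Sum>i\<in>I. u i) \<ge> a *\<^sub>R (\<Sum>i=1..N. u i)"

text \<open>
  The number \<open>f\<^bsub>N,d\<^esub>(a)\<close> with \<open>d = CARD('d)\<close>; the first argument only carries the
  index type. For \<open>0 \<le> a \<le> 1\<close> the set over which the minimum is taken is nonempty
  (see \<open>rich_number_exists\<close>), so \<open>LEAST\<close> denotes a genuine minimum.
\<close>

definition rich_number :: "'d::finite itself \<Rightarrow> nat \<Rightarrow> real \<Rightarrow> nat" where
  "rich_number (_ :: 'd itself) N a =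
     (LEAST f. \<forall>u :: nat \<Rightarrow> real ^ 'd. (\<forall>i\<in>{1..N}. u i \<ge> 0) \<longrightarrow>
        (\<exists>I. rich N u a I \<and> card I \<le> f))"

lemma rich_number_exists:
  fixes a :: real
  assumes "a \<le> 1"
  shows "\<exists>f. \<forall>u :: nat \<Rightarrow> real ^ 'd::finite. (\<forall>i\<in>{1..N}. u i \<ge> 0) \<longrightarrow>
           (\<exists>I. rich N u a I \<and> card I \<le> f)"
proof (intro exI[of _ N] allI impI exI[of _ "{1..N}"] conjI)
  fix u :: "nat \<Rightarrow> real ^ 'd"
  assume nonneg: "\<forall>i\<in>{1..N}. u i \<ge> 0"
  have "a * (\<Sum>i=1..N. u i $ j) \<le> (\<Sum>i=1..N. u i $ j)" for j
  proof -
    have "0 \<le> (\<Sum>i=1..N. u i $ j)"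
      using nonneg by (intro sum_nonneg) (simp add: less_eq_vec_def)
    from mult_right_mono[OF assms this] show ?thesis by simp
  qed
  then show "rich N u a {1..N}"
    by (simp add: rich_def less_eq_vec_def)
qed simp

end

theory Submission
  imports Defs
begin

text \<open>
  Upper bound: choose \<open>q\<close> fractional selections \<open>x(\<cdot>,k)\<close> with values in \<open>[0,1]\<close>, each
  giving exactly the share \<open>p/q\<close> of the total, such that every index has total weight \<open>p\<close>
  over all selections (the constant \<open>p/q\<close> does this). In a basic solution of this linear system
  the number of fractional entries is at most the number of indices carrying a fractional entry
  plus \<open>(q-1)d\<close>; since an index carrying one has at most \<open>p-1\<close> entries equal to \<open>1\<close>,
  the supports of the \<open>q\<close> selections have at most \<open>pN + (q-1)d\<close> elements altogether.
  The smallest support is the required rich set, as the bound in the theorem equals \<open>\<lfloor>(pN + (q-1)d)/q\<rfloor>\<close>.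

  Lower bound: take unit vectors, with \<open>d-1\<close> directions occurring \<open>b\<close> times each, where
  \<open>b\<close> is the inverse of \<open>p\<close> modulo \<open>q\<close>, and the last direction occurring in the
  remaining \<open>N - (d-1)b\<close> places. Then \<open>pb \<equiv> 1 (mod q)\<close> makes the rounding loss in each
  of the \<open>d-1\<close> directions maximal.
\<close>

section \<open>Basic solutions of linear systems in the unit cube\<close>

text \<open>Gaussian elimination, one equation per induction step: a variable with nonzero
  coefficient in \<open>e\<close> is eliminated from the other equations and recovered from
  \<open>e\<close> afterwards.\<close>

lemma homogeneous_system_nontrivial:
  fixes A :: "'e \<Rightarrow> 'v \<Rightarrow> 'a::field"
  assumes "finite E" "finite V" "card E < card V"
  shows "\<exists>z. (\<exists>v\<in>V. z v \<noteq> 0) \<and> (\<forall>e\<in>E. (\<Sum>v\<in>V. A e v * z v) = 0)"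
  using assms
proof (induction E arbitrary: V A rule: finite_induct)
  case empty
  then obtain v where "v \<in> V" by fastforce
  then show ?case by (intro exI[of _ "\<lambda>_. 1"]) auto
next
  case (insert e E)
  show ?case
  proof (cases "\<forall>v\<in>V. A e v = 0")
    case True
    from insert.IH[of V A] insert.prems insert.hyps
    obtain z where "\<exists>v\<in>V. z v \<noteq> 0" "\<forall>e\<in>E. (\<Sum>v\<in>V. A e v * z v) = 0" by auto
    with True show ?thesis by (intro exI[of _ z]) auto
  next
    case False
    then obtain w where w: "w \<in> V" "A e w \<noteq> 0" by blast
    define V' where "V' = V - {w}"
    define B where "B = (\<lambda>f v. A f v - A f w / A e w * A e v)"
    have V': "finite V'" "V = insert w V'" "w \<notin> V'"
      using w insert.prems by (auto simp: V'_def)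
    have "card E < card V'"
      using insert.prems insert.hyps V' by simp
    from insert.IH[OF V'(1) this, of B]
    obtain z where z: "\<exists>v\<in>V'. z v \<noteq> 0" "\<forall>f\<in>E. (\<Sum>v\<in>V'. B f v * z v) = 0" by auto
    define s where "s = (\<Sum>v\<in>V'. A e v * z v)"
    \<comment> \<open>The value at \<open>w\<close> is the one that solves row \<open>e\<close>;
      substituting it into the other rows turns their coefficients \<open>A\<close> into
      \<open>B\<close>.\<close>
    define z' where "z' = z(w := - s / A e w)"
    have sum_z': "(\<Sum>v\<in>V. A f v * z' v) = (\<Sum>v\<in>V'. A f v * z v) - A f w * s / A e w" for f
    proof -
      have "(\<Sum>v\<in>V'. A f v * z' v) = (\<Sum>v\<in>V'. A f v * z v)"
        using V' by (intro sum.cong) (auto simp: z'_def)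
      then show ?thesis using V' by (simp add: z'_def)
    qed
    have "(\<Sum>v\<in>V'. B f v * z v) = (\<Sum>v\<in>V'. A f v * z v) - A f w * s / A e w" for f
      by (simp add: B_def s_def algebra_simps sum_subtractf sum_distrib_left sum_divide_distrib)
    with z(2) sum_z' have "\<forall>f\<in>E. (\<Sum>v\<in>V. A f v * z' v) = 0" by simp
    moreover have "(\<Sum>v\<in>V. A e v * z' v) = 0"
      using w(2) by (simp add: sum_z' s_def)
    moreover have "\<exists>v\<in>V. z' v \<noteq> 0"
      using z(1) V' by (auto simp: z'_def)
    ultimately show ?thesis by (intro exI[of _ z']) auto
  qed
qed

text \<open>From an interior point the ray in direction \<open>z\<close> is followed until the first
  coordinate hits a face of the cube; \<open>T v\<close> is the time at which coordinate
  \<open>v\<close> would do so.\<close>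

lemma exit_unit_cube:
  fixes x z :: "'v \<Rightarrow> real"
  assumes "finite F" "\<forall>v\<in>F. 0 < x v \<and> x v < 1" "w \<in> F" "z w \<noteq> 0"
  shows "\<exists>t. (\<forall>v\<in>F. 0 \<le> x v + t * z v \<and> x v + t * z v \<le> 1) \<and>
             (\<exists>v\<in>F. x v + t * z v = 0 \<or> x v + t * z v = 1)"
proof -
  define T where "T v = (if z v > 0 then (1 - x v) / z v else - x v / z v)" for v
  \<comment> \<open>Coordinates with \<open>z v = 0\<close> never move; they are left out because
    division by zero would give them \<open>T v = 0\<close>.\<close>
  define G where "G = {v\<in>F. z v \<noteq> 0}"
  define t where "t = Min (T ` G)"
  have G: "finite G" "G \<noteq> {}" using assms by (auto simp: G_def)
  then have "t \<in> T ` G" unfolding t_def by (intro Min_in) auto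
  then obtain g where g: "g \<in> G" "t = T g" by auto
  have t_le: "t \<le> T v" if "v \<in> G" for v
    using G that by (simp add: t_def)
  have T_pos: "T v > 0" if "v \<in> G" for v
    using that assms(2) divide_pos_neg[of "x v" "z v"]
    by (cases "z v" "0 :: real" rule: linorder_cases) (auto simp: T_def G_def)
  have "t > 0" using g T_pos by simp
  have "0 \<le> x v + t * z v \<and> x v + t * z v \<le> 1" if v: "v \<in> F" for v
  proof -
    have xv: "0 < x v" "x v < 1" using assms(2) v by auto
    consider "z v = 0" | "z v > 0" | "z v < 0" by linarith
    then show ?thesis
    proof cases
      case 1
      then show ?thesis using xv by simp
    next
      case 2
      then have "t \<le> (1 - x v) / z v" using t_le[of v] v by (simp add: G_def T_def)
      then have "t * z v \<le> 1 - x v" using 2 by (simp add: field_simps)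
      moreover have "0 < t * z v" using 2 \<open>t > 0\<close> by simp
      ultimately show ?thesis using xv by linarith
    next
      case 3
      then have "t \<le> - x v / z v" using t_le[of v] v by (simp add: G_def T_def)
      then have "t * z v \<ge> - x v" using 3 by (simp add: field_simps)
      moreover have "t * z v < 0" using 3 \<open>t > 0\<close> by (simp add: mult_pos_neg)
      ultimately show ?thesis using xv by linarith
    qed
  qed
  moreover have "x g + t * z g = 0 \<or> x g + t * z g = 1"
    using g by (auto simp: G_def T_def)
  ultimately show ?thesis using g by (auto simp: G_def)
qed

text \<open>Among the feasible points one with the fewest fractional coordinates is taken. More such
  coordinates than equations touching them would leave a kernel vector along which a further
  coordinate reaches 0 or 1. Counting only the touched equations later separates the indices with a
  fractional entry from the others.\<close>

lemma basic_solution_unit_cube: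
  fixes A :: "'e \<Rightarrow> 'v \<Rightarrow> real" and b :: "'e \<Rightarrow> real"
  assumes fin: "finite E" "finite V"
    and feas: "\<forall>v\<in>V. 0 \<le> x0 v \<and> x0 v \<le> 1" "\<forall>e\<in>E. (\<Sum>v\<in>V. A e v * x0 v) = b e"
  obtains x where "\<forall>v\<in>V. 0 \<le> x v \<and> x v \<le> 1" "\<forall>e\<in>E. (\<Sum>v\<in>V. A e v * x v) = b e"
    "card {v\<in>V. 0 < x v \<and> x v < 1} \<le> card {e\<in>E. \<exists>v\<in>V. 0 < x v \<and> x v < 1 \<and> A e v \<noteq> 0}"
proof -
  define frac where "frac x = {v\<in>V. 0 < x v \<and> x v < 1}" for x :: "'v \<Rightarrow> real"
  define P where "P x \<longleftrightarrow> (\<forall>v\<in>V. 0 \<le> x v \<and> x v \<le> 1) \<and>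
    (\<forall>e\<in>E. (\<Sum>v\<in>V. A e v * x v) = b e)" for x
  have "P x0" using feas by (simp add: P_def)
  then obtain x where x: "P x" and min: "\<And>y. P y \<Longrightarrow> card (frac x) \<le> card (frac y)"
    using ex_has_least_nat[of P x0 "\<lambda>x. card (frac x)"] by blast
  define E' where "E' = {e\<in>E. \<exists>v\<in>V. 0 < x v \<and> x v < 1 \<and> A e v \<noteq> 0}"
  have "card (frac x) \<le> card E'"
  proof (rule ccontr)
    assume "\<not> ?thesis"
    then have lt: "card E' < card (frac x)" by simp
    have fins: "finite E'" "finite (frac x)" using fin by (auto simp: E'_def frac_def)
    from homogeneous_system_nontrivial[OF fins lt, of A] obtain z w where
      w: "w \<in> frac x" "z w \<noteq> 0" and z: "\<forall>e\<in>E'. (\<Sum>v\<in>frac x. A e v * z v) = 0" by blast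
    have "\<forall>v\<in>frac x. 0 < x v \<and> x v < 1" by (simp add: frac_def)
    from exit_unit_cube[OF fins(2) this, of w z, OF w] obtain t g where
      t: "\<forall>v\<in>frac x. 0 \<le> x v + t * z v \<and> x v + t * z v \<le> 1"
      and g: "g \<in> frac x" "x g + t * z g = 0 \<or> x g + t * z g = 1"
      by blast
    define y where "y v = (if v \<in> frac x then x v + t * z v else x v)" for v
    \<comment> \<open>Equations outside \<open>E'\<close> have zero coefficients on the fractional
      coordinates, so a kernel vector for \<open>E'\<close> respects all of
      \<open>E\<close>.\<close>
    have ker: "(\<Sum>v\<in>frac x. A e v * z v) = 0" if "e \<in> E" for e
    proof (cases "e \<in> E'")
      case False
      then have "\<forall>v\<in>frac x. A e v = 0" using that by (auto simp: E'_def frac_def)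
      then show ?thesis by simp
    qed (use z in auto)
    have "(\<Sum>v\<in>V. A e v * y v) = b e" if e: "e \<in> E" for e
    proof -
      have "(\<Sum>v\<in>V. A e v * y v) =
          (\<Sum>v\<in>V. A e v * x v + (if v \<in> frac x then t * (A e v * z v) else 0))"
        by (intro sum.cong) (auto simp: y_def algebra_simps)
      also have "\<dots> = (\<Sum>v\<in>V. A e v * x v) + (\<Sum>v\<in>V \<inter> frac x. t * (A e v * z v))"
        using fin by (simp add: sum.distrib sum.inter_restrict)
      also have "V \<inter> frac x = frac x" by (auto simp: frac_def)
      also have "(\<Sum>v\<in>frac x. t * (A e v * z v)) = t * (\<Sum>v\<in>frac x. A e v * z v)"
        by (simp add: sum_distrib_left)
      finally show ?thesis using x e ker[OF e] by (simp add: P_def)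
    qed
    moreover have "\<forall>v\<in>V. 0 \<le> y v \<and> y v \<le> 1"
      using x t by (auto simp: y_def P_def)
    ultimately have "P y" by (simp add: P_def)
    have "frac y \<subseteq> frac x - {g}"
    proof
      fix v assume v: "v \<in> frac y"
      have "v \<in> frac x" by (rule ccontr) (use v in \<open>auto simp: y_def frac_def\<close>)
      moreover have "v \<noteq> g" using v g by (auto simp: y_def frac_def)
      ultimately show "v \<in> frac x - {g}" by simp
    qed
    then have "card (frac y) < card (frac x)"
      using g fins by (intro psubset_card_mono) auto
    with min[OF \<open>P y\<close>] show False by simp
  qed
  then show ?thesis using x that[of x] by (simp add: P_def frac_def E'_def)
qed

section \<open>Existence of small rich sets\<close>

lemma card_eq_sum_card_fibres:
  assumes "finite A" "finite B" "S \<subseteq> A \<times> B"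
  shows "card S = (\<Sum>a\<in>A. card {b\<in>B. (a, b) \<in> S})"
    and "card S = (\<Sum>b\<in>B. card {a\<in>A. (a, b) \<in> S})"
proof -
  have "S = Sigma A (\<lambda>a. {b\<in>B. (a, b) \<in> S})" using assms by auto
  then have "card S = card (Sigma A (\<lambda>a. {b\<in>B. (a, b) \<in> S}))" by (rule arg_cong)
  also have "\<dots> = (\<Sum>a\<in>A. card {b\<in>B. (a, b) \<in> S})"
    using assms(1,2) by simp
  finally show "card S = (\<Sum>a\<in>A. card {b\<in>B. (a, b) \<in> S})" .
  have "prod.swap ` S = Sigma B (\<lambda>b. {a\<in>A. (a, b) \<in> S})" using assms by force
  then have "card (prod.swap ` S) = (\<Sum>b\<in>B. card {a\<in>A. (a, b) \<in> S})"
    using assms(1,2) by simp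
  then show "card S = (\<Sum>b\<in>B. card {a\<in>A. (a, b) \<in> S})"
    by (simp add: card_image)
qed

lemma fractional_selections:
  fixes u :: "nat \<Rightarrow> real ^ 'd::finite" and P Q N :: nat
  assumes Q: "Q > 0" "P \<le> Q"
  obtains x :: "nat \<times> nat \<Rightarrow> real" where
    "\<And>i k. i \<in> {1..N} \<Longrightarrow> k < Q \<Longrightarrow> 0 \<le> x (i, k) \<and> x (i, k) \<le> 1"
    "\<And>k. k < Q \<Longrightarrow> (\<Sum>i=1..N. x (i, k) *\<^sub>R u i) = (real P / real Q) *\<^sub>R (\<Sum>i=1..N. u i)"
    "card {v\<in>{1..N} \<times> {..<Q}. 0 < x v} \<le> P * N + (Q - 1) * CARD('d)"
proof -
  define V where "V = {1..N} \<times> {..<Q}"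
  define R where "R = {..<Q - 1} \<times> (UNIV :: 'd set)"
  \<comment> \<open>The share equations are imposed only for \<open>k < Q - 1\<close>: they imply the one for
    \<open>k = Q - 1\<close>, which is what keeps the count at \<open>(Q - 1) * CARD('d)\<close>.\<close>
  define E where "E = {1..N} <+> R"
  \<comment> \<open>Row \<open>Inl i\<close> fixes the total weight of index \<open>i\<close>; row
    \<open>Inr (k, j)\<close> fixes coordinate \<open>j\<close> of the share given by selection
    \<open>k\<close>.\<close>
  define A :: "nat + nat \<times> 'd \<Rightarrow> nat \<times> nat \<Rightarrow> real" where
    "A e v = (case e of Inl i \<Rightarrow> of_bool (fst v = i)
                      | Inr (k, j) \<Rightarrow> of_bool (snd v = k) * u (fst v) $ j)" for e v
  define b :: "nat + nat \<times> 'd \<Rightarrow> real" where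
    "b e = (case e of Inl i \<Rightarrow> real P
                    | Inr (k, j) \<Rightarrow> real P / real Q * (\<Sum>i=1..N. u i $ j))" for e
  have fin: "finite E" "finite V" by (auto simp: E_def V_def R_def)
  have rowI: "(\<Sum>v\<in>V. A (Inl i) v * x v) = (\<Sum>k<Q. x (i, k))" if "i \<in> {1..N}" for i x
  proof -
    have "(\<Sum>v\<in>V. A (Inl i) v * x v) = (\<Sum>i'=1..N. \<Sum>k<Q. of_bool (i' = i) * x (i', k))"
      unfolding V_def sum.cartesian_product by (intro sum.cong) (auto simp: A_def)
    also have "\<dots> = (\<Sum>i'=1..N. if i' = i then \<Sum>k<Q. x (i, k) else 0)"
      by (intro sum.cong) auto
    finally show ?thesis using that by simp
  qed
  have rowR: "(\<Sum>v\<in>V. A (Inr (k, j)) v * x v) = (\<Sum>i=1..N. x (i, k) * u i $ j)"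
    if "k < Q" for k j x
  proof -
    have "(\<Sum>v\<in>V. A (Inr (k, j)) v * x v)
        = (\<Sum>i=1..N. \<Sum>k'<Q. if k' = k then x (i, k) * u i $ j else 0)"
      unfolding V_def sum.cartesian_product
      by (intro sum.cong) (auto simp: A_def)
    then show ?thesis using that by simp
  qed
  have "\<forall>e\<in>E. (\<Sum>v\<in>V. A e v * (real P / real Q)) = b e"
  proof
    fix e assume "e \<in> E"
    then consider i where "i \<in> {1..N}" "e = Inl i" | k j where "k < Q - 1" "e = Inr (k, j)"
      by (auto simp: E_def R_def)
    then show "(\<Sum>v\<in>V. A e v * (real P / real Q)) = b e"
    proof cases
      case 1
      then show ?thesis using rowI[OF 1(1), of "\<lambda>_. real P / real Q"] Q by (simp add: b_def)
    next
      case 2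
      then have "k < Q" by simp
      with 2 show ?thesis using rowR[of k j "\<lambda>_. real P / real Q"]
        by (simp add: b_def sum_distrib_left)
    qed
  qed
  moreover have "\<forall>v\<in>V. 0 \<le> real P / real Q \<and> real P / real Q \<le> 1" using Q by simp
  ultimately obtain x where x: "\<forall>v\<in>V. 0 \<le> x v \<and> x v \<le> 1"
      "\<forall>e\<in>E. (\<Sum>v\<in>V. A e v * x v) = b e" and
      basic: "card {v\<in>V. 0 < x v \<and> x v < 1}
                \<le> card {e\<in>E. \<exists>v\<in>V. 0 < x v \<and> x v < 1 \<and> A e v \<noteq> 0}"
    using basic_solution_unit_cube[OF fin, of "\<lambda>_. real P / real Q" A b] by blast
  have bnd: "0 \<le> x (i, k) \<and> x (i, k) \<le> 1" if "i \<in> {1..N}" "k < Q" for i k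
    using x(1) that by (auto simp: V_def)
  have sumP: "(\<Sum>k<Q. x (i, k)) = real P" if "i \<in> {1..N}" for i
  proof -
    have "Inl i \<in> E" using that by (auto simp: E_def)
    then have "(\<Sum>v\<in>V. A (Inl i) v * x v) = b (Inl i)" using x(2) by blast
    then show ?thesis using rowI[OF that, of x] by (simp add: b_def)
  qed
  define U where "U = (\<Sum>i=1..N. u i)"
  define X where "X k = (\<Sum>i=1..N. x (i, k) *\<^sub>R u i)" for k
  have X_init: "X k = (real P / real Q) *\<^sub>R U" if "k < Q - 1" for k
  proof -
    have "X k $ j = ((real P / real Q) *\<^sub>R U) $ j" for j
    proof -
      have "Inr (k, j) \<in> E" using that by (auto simp: E_def R_def)
      then have "(\<Sum>v\<in>V. A (Inr (k, j)) v * x v) = b (Inr (k, j))" using x(2) by blast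
      then show ?thesis using rowR[of k j x] that by (simp add: b_def X_def U_def)
    qed
    then show ?thesis by (simp add: vec_eq_iff)
  qed
  \<comment> \<open>Each index has total weight \<open>P\<close>, so all shares together make
    \<open>P\<close> times the total; the \<open>Q - 1\<close> imposed shares leave
    \<open>P / Q\<close> for the last selection.\<close>
  have "(\<Sum>k<Q. X k) = real P *\<^sub>R U"
  proof -
    have "(\<Sum>k<Q. X k) = (\<Sum>i=1..N. \<Sum>k<Q. x (i, k) *\<^sub>R u i)"
      unfolding X_def by (rule sum.swap)
    also have "\<dots> = (\<Sum>i=1..N. real P *\<^sub>R u i)"
      by (intro sum.cong refl) (metis sumP scaleR_sum_left)
    finally show ?thesis by (simp add: U_def scaleR_sum_right)
  qed
  moreover have "(\<Sum>k<Q. X k) = (\<Sum>k<Q - 1. X k) + X (Q - 1)"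
    using Q by (metis Suc_diff_1 sum.lessThan_Suc)
  moreover have "(\<Sum>k<Q - 1. X k) = (real (Q - 1) * (real P / real Q)) *\<^sub>R U"
    by (simp add: X_init sum_constant_scaleR del: sum_constant)
  ultimately have "X (Q - 1) = (real P - real (Q - 1) * (real P / real Q)) *\<^sub>R U"
    by (simp add: algebra_simps)
  also have "real P - real (Q - 1) * (real P / real Q) = real P / real Q"
    using Q by (simp add: field_simps)
  finally have X_last: "X (Q - 1) = (real P / real Q) *\<^sub>R U" .
  have X: "X k = (real P / real Q) *\<^sub>R U" if "k < Q" for k
    using that X_init X_last by (cases "k = Q - 1") auto
  define F where "F = {v\<in>V. 0 < x v \<and> x v < 1}"
  define O' where "O' = {v\<in>V. x v = 1}"
  define T where "T = {i\<in>{1..N}. \<exists>k<Q. (i, k) \<in> F}"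
  \<comment> \<open>An index row meets a fractional entry only if its index lies in
    \<open>T\<close>; the share rows are all counted.\<close>
  have "{e\<in>E. \<exists>v\<in>V. 0 < x v \<and> x v < 1 \<and> A e v \<noteq> 0} \<subseteq> T <+> R"
    by (auto simp: E_def T_def F_def V_def A_def of_bool_def split: if_splits)
  then have "card F \<le> card (T <+> R)"
    unfolding F_def by (intro order.trans[OF basic] card_mono) (auto simp: T_def R_def)
  also have "\<dots> = card T + (Q - 1) * CARD('d)"
    by (simp add: card_Plus T_def R_def)
  finally have cF: "card F \<le> card T + (Q - 1) * CARD('d)" .
  \<comment> \<open>The entries of an index sum to the integer \<open>P\<close>, so a positive
    fractional entry leaves room for at most \<open>P - 1\<close> ones.\<close>
  have ones: "card {k\<in>{..<Q}. (i, k) \<in> O'} + of_bool (i \<in> T) \<le> P" if i: "i \<in> {1..N}" for i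
  proof -
    let ?O = "{k\<in>{..<Q}. (i, k) \<in> O'}"
    have split: "real P = real (card ?O) + (\<Sum>k\<in>{..<Q} - ?O. x (i, k))"
    proof -
      have "(\<Sum>k\<in>?O. x (i, k)) = (\<Sum>k\<in>?O. 1)"
        by (intro sum.cong) (auto simp: O'_def)
      then show ?thesis
        using sum.subset_diff[of ?O "{..<Q}" "\<lambda>k. x (i, k)"] sumP[OF i]
        by (simp add: subset_iff)
    qed
    have nn: "0 \<le> x (i, k)" if "k \<in> {..<Q} - ?O" for k using bnd[OF i] that by auto
    show ?thesis
    proof (cases "i \<in> T")
      case True
      then obtain k where k: "k < Q" "(i, k) \<in> F" by (auto simp: T_def)
      then have "0 < (\<Sum>k\<in>{..<Q} - ?O. x (i, k))"
        using nn by (intro sum_pos2[of _ k]) (auto simp: F_def O'_def)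
      with split have "card ?O < P" by linarith
      with True show ?thesis by simp
    next
      case False
      have "0 \<le> (\<Sum>k\<in>{..<Q} - ?O. x (i, k))" by (rule sum_nonneg) (rule nn)
      with split False show ?thesis by simp
    qed
  qed
  have "card O' + card T = (\<Sum>i=1..N. card {k\<in>{..<Q}. (i, k) \<in> O'} + of_bool (i \<in> T))"
  proof -
    have "card T = (\<Sum>i=1..N. of_bool (i \<in> T))"
      by (simp add: T_def sum.If_cases of_bool_def Int_def)
    moreover have "card O' = (\<Sum>i=1..N. card {k\<in>{..<Q}. (i, k) \<in> O'})"
      by (rule card_eq_sum_card_fibres) (auto simp: O'_def V_def)
    ultimately show ?thesis by (simp add: sum.distrib)
  qed
  also have "\<dots> \<le> (\<Sum>i=1..N. P)" by (intro sum_mono ones)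
  finally have cO: "card O' + card T \<le> P * N" by (simp add: mult.commute)
  \<comment> \<open>Positive entries are fractional or one; on adding \<open>cF\<close> and
    \<open>cO\<close> the term \<open>card T\<close> cancels.\<close>
  have "{v\<in>V. 0 < x v} = F \<union> O'"
    using x(1) by (auto simp: F_def O'_def less_eq_real_def)
  then have "card {v\<in>V. 0 < x v} \<le> card F + card O'" by (simp add: card_Un_le)
  with cF cO have "card {v\<in>V. 0 < x v} \<le> P * N + (Q - 1) * CARD('d)" by linarith
  with bnd X show ?thesis using that[of x] by (simp add: X_def U_def V_def)
qed

text \<open>Some selection has a support of at most average size. Raising its positive entries to 1
  cannot lower the share, since the vectors are nonnegative.\<close>

lemma small_rich_set:
  fixes u :: "nat \<Rightarrow> real ^ 'd::finite" and P Q N :: nat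
  assumes Q: "Q > 0" "P \<le> Q" and nonneg: "\<forall>i\<in>{1..N}. u i \<ge> 0"
  obtains I where "rich N u (real P / real Q) I"
    "card I \<le> (P * N + (Q - 1) * CARD('d)) div Q"
proof -
  obtain x :: "nat \<times> nat \<Rightarrow> real" where
    bnd: "\<And>i k. i \<in> {1..N} \<Longrightarrow> k < Q \<Longrightarrow> 0 \<le> x (i, k) \<and> x (i, k) \<le> 1"
    and share: "\<And>k. k < Q \<Longrightarrow>
      (\<Sum>i=1..N. x (i, k) *\<^sub>R u i) = (real P / real Q) *\<^sub>R (\<Sum>i=1..N. u i)"
    and supp: "card {v\<in>{1..N} \<times> {..<Q}. 0 < x v} \<le> P * N + (Q - 1) * CARD('d)"
    using fractional_selections[OF Q, of N u] by blast
  define I where "I k = {i\<in>{1..N}. 0 < x (i, k)}" for k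
  define M where "M = P * N + (Q - 1) * CARD('d)"
  have "card {v\<in>{1..N} \<times> {..<Q}. 0 < x v} =
      (\<Sum>k<Q. card {i\<in>{1..N}. (i, k) \<in> {v\<in>{1..N} \<times> {..<Q}. 0 < x v}})"
    by (rule card_eq_sum_card_fibres(2)) auto
  also have "\<dots> = (\<Sum>k<Q. card (I k))"
    by (intro sum.cong arg_cong[of _ _ card]) (auto simp: I_def)
  finally have sumI: "(\<Sum>k<Q. card (I k)) \<le> M" using supp by (simp add: M_def)
  have "\<exists>k<Q. card (I k) \<le> M div Q"
  proof (rule ccontr)
    assume "\<not> ?thesis"
    then have "(\<Sum>k<Q. Suc (M div Q)) \<le> (\<Sum>k<Q. card (I k))"
      by (intro sum_mono) (auto simp: not_le Suc_le_eq)
    with sumI have "Q * Suc (M div Q) \<le> M" by simp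
    with dividend_less_times_div[OF Q(1), of M] show False by simp
  qed
  then obtain k where k: "k < Q" "card (I k) \<le> M div Q" by blast
  have "rich N u (real P / real Q) (I k)"
    unfolding rich_def less_eq_vec_def
  proof (intro conjI allI)
    show "I k \<subseteq> {1..N}" by (auto simp: I_def)
    fix j
    have "((real P / real Q) *\<^sub>R (\<Sum>i=1..N. u i)) $ j = (\<Sum>i=1..N. x (i, k) * u i $ j)"
      unfolding share[OF k(1), symmetric] by simp
    also have "\<dots> = (\<Sum>i\<in>I k. x (i, k) * u i $ j)"
      using bnd k(1) by (intro sum.mono_neutral_right) (force simp: I_def)+
    also have "\<dots> \<le> (\<Sum>i\<in>I k. u i $ j)"
      using bnd k(1) nonneg
      by (intro sum_mono mult_left_le_one_le) (auto simp: I_def less_eq_vec_def)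
    finally show "((real P / real Q) *\<^sub>R (\<Sum>i=1..N. u i)) $ j \<le> (\<Sum>i\<in>I k. u i) $ j" by simp
  qed
  with k(2) that show ?thesis by (simp add: M_def)
qed

lemma rich_number_le:
  fixes P Q N :: nat
  assumes "Q > 0" "P \<le> Q"
  shows "rich_number TYPE('d::finite) N (real P / real Q)
           \<le> (P * N + (Q - 1) * CARD('d)) div Q"
  unfolding rich_number_def
proof (intro Least_le allI impI)
  fix u :: "nat \<Rightarrow> real ^ 'd"
  assume "\<forall>i\<in>{1..N}. u i \<ge> 0"
  from small_rich_set[OF assms this]
  show "\<exists>I. rich N u (real P / real Q) I \<and> card I \<le> (P * N + (Q - 1) * CARD('d)) div Q"
    by metis
qed

section \<open>Sharpness\<close>

text \<open>Serves to distribute unit vectors over the indices with prescribed multiplicities: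
  \<open>c\<close> is the block label under a bijection onto a disjoint union of blocks of sizes
  \<open>s j\<close>.\<close>

lemma exists_map_with_fibre_cards:
  fixes s :: "'j::finite \<Rightarrow> nat"
  assumes "finite A" "(\<Sum>j\<in>UNIV. s j) = card A"
  obtains c where "\<And>j. card {a\<in>A. c a = j} = s j"
proof -
  define B where "B = Sigma (UNIV :: 'j set) (\<lambda>j. {..<s j})"
  have "card B = card A" "finite B" using assms(2) by (simp_all add: B_def)
  with assms(1) obtain h where h: "bij_betw h A B" by (metis finite_same_card_bij)
  have "card {a\<in>A. fst (h a) = j} = s j" for j
  proof -
    have "h ` {a\<in>A. fst (h a) = j} = {j} \<times> {..<s j}"
    proof -
      have "h ` {a\<in>A. fst (h a) = j} = {y \<in> h ` A. fst y = j}" by auto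
      also have "\<dots> = {j} \<times> {..<s j}"
        using bij_betw_imp_surj_on[OF h] by (auto simp: B_def)
      finally show ?thesis .
    qed
    then have "bij_betw h {a\<in>A. fst (h a) = j} ({j} \<times> {..<s j})"
      by (intro bij_betw_subset[OF h]) auto
    from bij_betw_same_card[OF this] show ?thesis by simp
  qed
  then show ?thesis using that[of "\<lambda>a. fst (h a)"] by simp
qed

text \<open>In every direction but one a rich set must round its share up by
  \<open>(q - 1) / q\<close>, the largest possible loss for a multiple of
  \<open>1 / q\<close>.\<close>

lemma rich_number_ge:
  fixes p q :: int and N :: nat
  assumes "1 \<le> p" "p < q" "gcd p q = 1" "int N \<ge> (q - 1) * (int CARD('d::finite) - 1)"
  shows "(p * int N + (q - 1) * int CARD('d)) div q
           \<le> int (rich_number TYPE('d) N (of_int p / of_int q))"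
proof -
  let ?a = "of_int p / of_int q :: real"
  define d where "d = CARD('d)"
  have d: "d \<ge> 1" by (simp add: d_def Suc_leI)
  obtain r s where "r * p + s * q = 1" using bezout_int[of p q] assms(3) by metis
  then have "p * r = 1 + q * (- s)" by (simp add: algebra_simps)
  then have "(p * r) mod q = 1" using assms(1,2) by (simp only: mod_mult_self2) simp
  then have inverse: "(p * (r mod q)) mod q = 1" by (simp add: mod_mult_right_eq)
  \<comment> \<open>Reduction modulo \<open>q\<close> gives \<open>b \<le> q - 1\<close>, so the
    hypothesis on \<open>N\<close> leaves room for \<open>b\<close> copies of each of
    \<open>d - 1\<close> directions.\<close>
  define b where "b = r mod q"
  have b: "0 \<le> b" "b \<le> q - 1" using assms by (auto simp: b_def)
  define t where "t = (p * b) div q"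
  \<comment> \<open>The share required from \<open>b\<close> copies is \<open>t + 1 / q\<close>,
    just above an integer, which forces \<open>t + 1\<close> chosen copies.\<close>
  have t: "p * b = q * t + 1"
    using inverse mult_div_mod_eq[of q "p * b"]
    by (simp add: b_def t_def)
  have "b * (int d - 1) \<le> int N"
    using assms(4) b d mult_right_mono[of b "q - 1" "int d - 1"] by (simp add: d_def)
  then have "int (nat b * (d - 1)) \<le> int N"
    using b d by simp
  then have dbN: "nat b * (d - 1) \<le> N" by (simp only: of_nat_le_iff)
  \<comment> \<open>An arbitrary direction, which absorbs the places left over by the
    others.\<close>
  fix j0 :: 'd
  define m where "m j = (if j = j0 then N - nat b * (d - 1) else nat b)" for j
  have UNIV_split: "(\<Sum>j\<in>UNIV. g j) = g j0 + (\<Sum>j\<in>UNIV - {j0}. g j)"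
    for g :: "'d \<Rightarrow> 'x::comm_monoid_add"
    by (simp add: sum.remove)
  have card_rest: "card (UNIV - {j0}) = d - 1" by (simp add: d_def)
  have "(\<Sum>j\<in>UNIV. m j) = card {1..N}"
    using dbN card_rest by (simp add: UNIV_split m_def mult.commute)
  then obtain c where c: "\<And>j. card {i\<in>{1..N}. c i = j} = m j"
    using exists_map_with_fibre_cards[of "{1..N}" m] by auto
  define u where "u i = axis (c i) (1::real)" for i
  have u_sum: "(\<Sum>i\<in>I. u i) $ j = real (card {i\<in>I. c i = j})" if "finite I" for I j
    using that by (simp add: u_def axis_def sum.If_cases Int_def eq_commute)
  have a: "?a \<le> 1" using assms by simp
  have "\<forall>i\<in>{1..N}. u i \<ge> 0" by (simp add: u_def axis_def less_eq_vec_def)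
  \<comment> \<open>The minimum is attained, so \<open>rich_number\<close> itself bounds the size of
    some rich set for this \<open>u\<close>.\<close>
  with LeastI_ex[OF rich_number_exists[OF a, of N, where 'd='d]] obtain I where
    I: "rich N u ?a I" "card I \<le> rich_number TYPE('d) N ?a"
    unfolding rich_number_def by blast
  then have "finite I"
    by (auto simp: rich_def intro: finite_subset)
  define n where "n j = int (card {i\<in>I. c i = j})" for j
  have n: "p * int (m j) \<le> q * n j" for j
  proof -
    have "?a * real (m j) \<le> of_int (n j)"
      using I(1) u_sum[OF \<open>finite I\<close>, of j] u_sum[of "{1..N}" j] c[of j]
      by (simp add: rich_def less_eq_vec_def n_def) (metis sum_component)
    then have "of_int (p * int (m j)) \<le> (of_int (q * n j) :: real)"
      using assms by (simp add: field_simps)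
    then show ?thesis by (simp only: of_int_le_iff)
  qed
  have n_rest: "t + 1 \<le> n j" if "j \<noteq> j0" for j
  proof -
    have "q * t + 1 \<le> q * n j" using n[of j] that t b by (simp add: m_def)
    then have "q * t < q * n j" by linarith
    then have "t < n j" using assms by (simp add: mult_less_cancel_left_pos)
    then show ?thesis by simp
  qed
  have "card I = (\<Sum>j\<in>UNIV. card {i\<in>I. c i = j})"
    using \<open>finite I\<close> sum.group[of I UNIV c "\<lambda>_. 1 :: nat"] by simp
  then have "q * int (card I) = q * n j0 + q * (\<Sum>j\<in>UNIV - {j0}. n j)"
    by (simp add: UNIV_split n_def algebra_simps)
  moreover have "(\<Sum>j\<in>UNIV - {j0}. t + 1) \<le> (\<Sum>j\<in>UNIV - {j0}. n j)"
    by (intro sum_mono n_rest) auto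
  then have "q * ((int d - 1) * (t + 1)) \<le> q * (\<Sum>j\<in>UNIV - {j0}. n j)"
    using card_rest d assms by simp
  moreover have "int (m j0) = int N - b * (int d - 1)"
    using dbN b d by (simp add: m_def)
  with n[of j0] have "p * int N - (p * b) * (int d - 1) \<le> q * n j0"
    by (simp add: algebra_simps)
  \<comment> \<open>By \<open>p * b = q * t + 1\<close>, each direction other than \<open>j0\<close>
    contributes a surplus of \<open>q * (t + 1) - p * b = q - 1\<close>.\<close>
  ultimately have "p * int N + (q - 1) * (int d - 1) \<le> q * int (card I)"
    unfolding t by (simp add: algebra_simps)
  \<comment> \<open>The extra \<open>q - 1\<close> on both sides gives the left side the form of the
    bound and is lost on the right under division by \<open>q\<close>.\<close>
  then have "p * int N + (q - 1) * int d \<le> q * int (card I) + (q - 1)"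
    by (simp add: algebra_simps)
  then have "(p * int N + (q - 1) * int d) div q \<le> (q * int (card I) + (q - 1)) div q"
    using assms by (intro zdiv_mono1) auto
  also have "\<dots> = int (card I)"
    using assms by (intro int_div_pos_eq[where r = "q - 1"]) auto
  finally show ?thesis using I(2) by (simp add: d_def)
qed

section \<open>The bound as an integer quotient, and the theorem\<close>

text \<open>For an integer \<open>x\<close>, the ceiling of \<open>x / q\<close> is
  \<open>(x + q - 1) div q\<close>, and \<open>d - 1\<close> enters the division as
  \<open>(d - 1) * q\<close>. The quotient form is the one both counting arguments produce.\<close>

lemma ceiling_bound_eq_div:
  fixes p q d :: int and N :: nat
  assumes "q > 0"
  shows "(d - 1) + \<lceil>(of_int p * real N - of_int d + 1) / of_int q\<rceil>
           = (p * int N + (q - 1) * d) div q"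
proof -
  have "\<lceil>(of_int p * real N - of_int d + 1) / of_int q\<rceil>
      = \<lceil>real_of_int (p * int N - d + 1) / of_int q\<rceil>" by simp
  also have "\<dots> = - ((- (p * int N - d + 1)) div q)" by (rule ceiling_divide_eq_div)
  also have "\<dots> = (p * int N - d + q) div q"
  proof (rule int_div_pos_eq[symmetric])
    let ?X = "- (p * int N - d + 1)"
    \<comment> \<open>Negation replaces the remainder \<open>r\<close> of \<open>?X\<close> by its
      complement \<open>q - 1 - r\<close>.\<close>
    show "p * int N - d + q = q * - (?X div q) + (q - 1 - ?X mod q)"
      using mult_div_mod_eq[of q ?X] by linarith
    show "0 \<le> q - 1 - ?X mod q" "q - 1 - ?X mod q < q"
      using pos_mod_bound[OF assms, of ?X] pos_mod_sign[OF assms, of ?X] by linarith+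
  qed
  also have "(d - 1) + \<dots> = (p * int N - d + q + (d - 1) * q) div q"
    using assms by simp
  finally show ?thesis by (simp add: algebra_simps)
qed

theorem theorem1:
  fixes N :: nat and p q :: int
  assumes "N > 0"
    and "p \<ge> 0" and "q > 0" and "gcd p q = 1"
    and "of_int p / of_int q \<in> {0..1::real}"
  shows "int (rich_number TYPE('d::finite) N (of_int p / of_int q))
           \<le> (int CARD('d) - 1) + \<lceil>(of_int p * real N - real CARD('d) + 1) / of_int q\<rceil>
       \<and> (q > p \<and> p \<ge> 1 \<and> int N \<ge> (q - 1) * (int CARD('d) - 1) \<longrightarrow>
          int (rich_number TYPE('d) N (of_int p / of_int q))
           = (int CARD('d) - 1) + \<lceil>(of_int p * real N - real CARD('d) + 1) / of_int q\<rceil>)"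
proof -
  have bound: "(int CARD('d) - 1) + \<lceil>(of_int p * real N - real CARD('d) + 1) / of_int q\<rceil>
      = (p * int N + (q - 1) * int CARD('d)) div q"
    using ceiling_bound_eq_div[OF assms(3), of "int CARD('d)" p N] by simp
  obtain P Q where PQ: "p = int P" "q = int Q"
    using assms(2,3) by (metis nonneg_int_cases less_imp_le)
  have Q: "Q > 0" "P \<le> Q" using assms(3,5) PQ by (simp_all add: field_simps)
  have "int (rich_number TYPE('d) N (of_int p / of_int q))
      \<le> int ((P * N + (Q - 1) * CARD('d)) div Q)"
    using rich_number_le[OF Q, of N, where 'd='d] PQ by simp
  also have "\<dots> = (p * int N + (q - 1) * int CARD('d)) div q"
    using Q PQ by (simp add: zdiv_int)
  finally have le: "int (rich_number TYPE('d) N (of_int p / of_int q))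
      \<le> (p * int N + (q - 1) * int CARD('d)) div q" .
  show ?thesis
    unfolding bound using le rich_number_ge[of p q N, where 'd='d] assms(4)
    by (auto intro: antisym)
qed

end
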